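(* Let $n,p$ be positive coprime integers and let $x,y\in\mathfrak D_{n,p}$ be rational Dyck paths such that $d_{i,j}(x)=d_{i,j}(y)$ for all $i,j\in[n]$ with $i<j$. Then $x=y$.
   Context: A rational Dyck path is a lattice path from $(0,0)$ with $n$ North steps $(0,1)$ and $p$ East steps $(1,0)$ never going below the line of slope $n/p$ through the origin; $\mathfrak D_{n,p}$ is the set of these. The unit square with bottom-right corner $(i,j)$ gets label $\ell_{i,j}=jp-in$; each step of a path gets the label of its starting point $(i,j)$. Let $\ell_1<\dots<\ell_n$ be the labels of the North steps of $x$, and $H(x)$ the set of positive labels of unit squares lying below $x$ (between $x$ and the diagonal). The codinv tableau of $x$ is $d_{i,j}(x)=\#\{h\in H(x):\ell_i<h<\ell_i+p,\ h\equiv\ell_j\pmod n\}$ for $i<j$ in $[n]$. *)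

theory Defs
  imports "HOL-Number_Theory.Cong"
begin

datatype step = North | East

text \<open>A path starting at the origin is its list of steps; \<open>pos x k\<close> is the starting point
  \<open>(i, j)\<close> of the step \<open>x ! k\<close> (horizontal coordinate first).\<close>

definition pos :: "step list \<Rightarrow> nat \<Rightarrow> nat \<times> nat" where
  "pos x k = (count_list (take k x) East, count_list (take k x) North)"

definition lab :: "nat \<Rightarrow> nat \<Rightarrow> nat \<times> nat \<Rightarrow> int" where
  "lab n p = (\<lambda>(i, j). int j * int p - int i * int n)"

text \<open>A point \<open>(i, j)\<close> is not below the line of slope \<open>n / p\<close> through the origin iff
  \<open>i * n \<le> j * p\<close>. Since steps are axis-parallel unit segments, it suffices to test the
  lattice points of the path.\<close>

definition rational_dyck_paths :: "nat \<Rightarrow> nat \<Rightarrow> step list set" where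
  "rational_dyck_paths n p =
    {x. count_list x North = n \<and> count_list x East = p \<and>
        (\<forall>k\<le>length x. fst (pos x k) * n \<le> snd (pos x k) * p)}"

definition north_labels :: "nat \<Rightarrow> nat \<Rightarrow> step list \<Rightarrow> int set" where
  "north_labels n p x = {lab n p (pos x k) |k. k < length x \<and> x ! k = North}"

text \<open>The \<open>i\<close>-th smallest North label, indexed from 1. For coprime \<open>n\<close>, \<open>p\<close> the labels of the
  \<open>n\<close> North steps of a path in \<open>rational_dyck_paths n p\<close> are pairwise distinct.\<close>

definition north_label :: "nat \<Rightarrow> nat \<Rightarrow> step list \<Rightarrow> nat \<Rightarrow> int" where
  "north_label n p x i = sorted_list_of_set (north_labels n p x) ! (i - 1)"

text \<open>Unit squares are named by their bottom-right corner: \<open>(i, j)\<close> stands for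
  \<open>[i - 1, i] \<times> [j, j + 1]\<close>. It lies below the path iff the East step of the path in that
  column, from \<open>(i - 1, h)\<close> to \<open>(i, h)\<close>, has \<open>h \<ge> j + 1\<close>.\<close>

definition squares_below :: "step list \<Rightarrow> (nat \<times> nat) set" where
  "squares_below x =
    {(i, j). \<exists>k<length x. x ! k = East \<and> i = fst (pos x k) + 1 \<and> j + 1 \<le> snd (pos x k)}"

text \<open>The label of a square is positive iff its bottom-right corner, hence the whole square, lies
  strictly above the diagonal.\<close>

definition H :: "nat \<Rightarrow> nat \<Rightarrow> step list \<Rightarrow> int set" where
  "H n p x = {h \<in> lab n p ` squares_below x. h > 0}"

definition codinv :: "nat \<Rightarrow> nat \<Rightarrow> step list \<Rightarrow> nat \<Rightarrow> nat \<Rightarrow> nat" where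
  "codinv n p x i j =
    card {h \<in> H n p x. north_label n p x i < h \<and> h < north_label n p x i + int p \<and>
                       [h = north_label n p x j] (mod int n)}"

end

theory Submission
  imports Defs
begin

text \<open>Index the steps of a path by their direction and their rank among the labels of the steps in
  that direction. The labels of the starting points and the labels of the end points form the same
  set, because the path returns to the label 0. Comparing sums over the two families, the \<open>j\<close>-th
  column sum of the codinv tableau is the number of East steps starting below \<open>\<ell>\<^sub>j\<close>, and the \<open>i\<close>-th
  row sum is the number of East steps ending at or above \<open>\<ell>\<^sub>i + p\<close>. So the tableau determines the
  relative order of all starting points and that of all end points. As both exhaust the same set of
  labels, this determines which step starts where a given step ends, hence the path, which begins at
  the least label.\<close>

section \<open>Bijections determined by order\<close>

lemma strict_mono_on_less_iff_le_card:
  fixes f :: "nat \<Rightarrow> 'a :: linorder"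
  assumes "strict_mono_on {1..m} f" "k \<in> {1..m}"
  shows "f k < t \<longleftrightarrow> k \<le> card {j \<in> {1..m}. f j < t}"
proof
  assume "f k < t"
  then have "f j < t" if "j \<in> {1..k}" for j
    using strict_mono_on_leD[OF assms(1), of j k] that assms(2) by auto
  then have "{1..k} \<subseteq> {j \<in> {1..m}. f j < t}"
    using assms(2) by auto
  then have "card {1..k} \<le> card {j \<in> {1..m}. f j < t}"
    by (intro card_mono) auto
  then show "k \<le> card {j \<in> {1..m}. f j < t}"
    by simp
next
  assume k: "k \<le> card {j \<in> {1..m}. f j < t}"
  show "f k < t"
  proof (rule ccontr)
    assume "\<not> f k < t"
    then have "{j \<in> {1..m}. f j < t} \<subseteq> {1..<k}"
      using strict_mono_on_less[OF assms(1)] assms(2) by force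
    then have "card {j \<in> {1..m}. f j < t} \<le> card {1..<k}"
      by (intro card_mono) auto
    then show False
      using k assms(2) by auto
  qed
qed

lemma bij_betw_eq_iff_card_less:
  fixes f :: "'a \<Rightarrow> 'b :: linorder"
  assumes "bij_betw f A S" "finite S" "a \<in> A" "s \<in> S"
  shows "f a = s \<longleftrightarrow> card {c \<in> A. f c < f a} = card {t \<in> S. t < s}"
proof -
  have "inj_on f {c \<in> A. f c < f a}"
    using bij_betw_imp_inj_on[OF assms(1)] by (rule inj_on_subset) blast
  then have "card {c \<in> A. f c < f a} = card (f ` {c \<in> A. f c < f a})"
    by (rule card_image[symmetric])
  also have "f ` {c \<in> A. f c < f a} = {t \<in> S. t < f a}"
    using assms(1) by (auto simp: bij_betw_def)
  finally have card_eq: "card {c \<in> A. f c < f a} = card {t \<in> S. t < f a}" .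
  have card_less: "card {t \<in> S. t < u} < card {t \<in> S. t < v}" if "u < v" "u \<in> S" for u v
    using that assms(2) by (intro psubset_card_mono) auto
  have "f a \<in> S"
    using bij_betwE[OF assms(1)] assms(3) by blast
  then show ?thesis
    using card_eq card_less[of "f a" s] card_less[of s "f a"] assms(4)
    by (cases "f a" s rule: linorder_cases) simp_all
qed

lemma bij_betw_matching_determined_by_order:
  fixes f g :: "'a \<Rightarrow> 'b :: linorder" and f' g' :: "'a \<Rightarrow> 'c :: linorder"
  assumes "finite A"
    and f: "bij_betw f A S" and g: "bij_betw g A S"
    and f': "bij_betw f' A S'" and g': "bij_betw g' A S'"
    and f_less: "\<And>a b. a \<in> A \<Longrightarrow> b \<in> A \<Longrightarrow> f a < f b \<longleftrightarrow> f' a < f' b"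
    and g_less: "\<And>a b. a \<in> A \<Longrightarrow> b \<in> A \<Longrightarrow> g a < g b \<longleftrightarrow> g' a < g' b"
    and ab: "a \<in> A" "b \<in> A"
  shows "f a = g b \<longleftrightarrow> f' a = g' b"
proof -
  have fin: "finite S" "finite S'"
    using \<open>finite A\<close> bij_betw_finite f f' by blast+
  have "f a = g b \<longleftrightarrow> card {c \<in> A. f c < f a} = card {c \<in> A. g c < g b}"
    using bij_betw_eq_iff_card_less[OF f fin(1) ab(1), of "g b"]
      bij_betw_eq_iff_card_less[OF g fin(1) ab(2), of "g b"] bij_betwE[OF g] ab by simp
  also have "\<dots> \<longleftrightarrow> card {c \<in> A. f' c < f' a} = card {c \<in> A. g' c < g' b}"
    using f_less g_less ab by (simp cong: conj_cong)
  also have "\<dots> \<longleftrightarrow> f' a = g' b"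
    using bij_betw_eq_iff_card_less[OF f' fin(2) ab(1), of "g' b"]
      bij_betw_eq_iff_card_less[OF g' fin(2) ab(2), of "g' b"] bij_betwE[OF g'] ab by simp
  finally show ?thesis .
qed

lemma strict_mono_on_nth_sorted_list_of_set:
  "strict_mono_on {1..card A} (\<lambda>i. sorted_list_of_set A ! (i - 1))"
  by (intro strict_mono_onI sorted_wrt_nth_less[OF strict_sorted_list_of_set]) auto

lemma bij_betw_nth_sorted_list_of_set:
  assumes "finite A"
  shows "bij_betw (\<lambda>i. sorted_list_of_set A ! (i - 1)) {1..card A} A"
proof -
  have "bij_betw (\<lambda>i. i - 1) {1..card A} {..<card A}"
    by (rule bij_betw_byWitness[where f' = Suc]) auto
  moreover have "bij_betw ((!) (sorted_list_of_set A)) {..<card A} A"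
    using assms by (intro bij_betw_nth) auto
  ultimately show ?thesis
    using bij_betw_trans by (fastforce simp: comp_def)
qed

section \<open>Lattice paths\<close>

lemma card_nth_eq_count_list: "card {k. k < length xs \<and> xs ! k = a} = count_list xs a"
  by (simp add: count_list_eq_length_filter length_filter_conv_card eq_commute)

lemma count_list_take_Suc:
  "k < length xs \<Longrightarrow>
    count_list (take (Suc k) xs) a = count_list (take k xs) a + of_bool (xs ! k = a)"
  by (simp add: take_Suc_conv_app_nth)

lemma count_list_take_mono:
  assumes "k \<le> m"
  shows "count_list (take k xs) a \<le> count_list (take m xs) a"
proof -
  have "take m xs = take k xs @ take (m - k) (drop k xs)"
    using assms by (metis le_add_diff_inverse take_add)
  then show ?thesis
    by simp
qed

lemma count_list_take_less:
  assumes "k < m" "k < length xs" "xs ! k = a"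
  shows "count_list (take k xs) a < count_list (take m xs) a"
  using count_list_take_mono[of "Suc k" m xs a] count_list_take_Suc[of k xs a] assms by simp

lemma inj_on_count_list_take:
  "inj_on (\<lambda>k. count_list (take k xs) a) {k. k < length xs \<and> xs ! k = a}"
  by (rule linorder_inj_onI) (use count_list_take_less[of _ _ xs a] in force)+

lemma obtain_count_list_take:
  assumes "j < count_list xs a"
  obtains k where "k < length xs" "xs ! k = a" "count_list (take k xs) a = j"
proof -
  let ?K = "{k. k < length xs \<and> xs ! k = a}"
  have "(\<lambda>k. count_list (take k xs) a) ` ?K = {..<count_list xs a}"
  proof (rule card_subset_eq)
    show "(\<lambda>k. count_list (take k xs) a) ` ?K \<subseteq> {..<count_list xs a}"
      using count_list_take_less[of _ "length xs" xs a] by auto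
    show "card ((\<lambda>k. count_list (take k xs) a) ` ?K) = card {..<count_list xs a}"
      by (simp add: card_image inj_on_count_list_take card_nth_eq_count_list)
  qed simp
  then have "j \<in> (\<lambda>k. count_list (take k xs) a) ` ?K"
    using assms by simp
  then show ?thesis
    using that by blast
qed

lemma length_eq_count_East_North: "length x = count_list x East + count_list x North"
proof (induction x)
  case (Cons s x)
  then show ?case
    by (cases s) auto
qed simp

lemma squares_below_eq:
  "squares_below x = {(i, j). \<exists>m<length x. x ! m = North \<and> snd (pos x m) = j \<and>
     fst (pos x m) < i \<and> i \<le> count_list x East}"
proof (intro set_eqI iffI; clarify)
  fix i j
  assume "(i, j) \<in> squares_below x"
  then obtain k where k: "k < length x" "x ! k = East"
    and i: "i = fst (pos x k) + 1" and j: "j < snd (pos x k)"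
    by (auto simp: squares_below_def)
  have "j < count_list x North"
    using j count_list_take_mono[of k "length x" x North] k by (simp add: pos_def)
  then obtain m where m: "m < length x" "x ! m = North" "snd (pos x m) = j"
    by (auto simp: pos_def elim: obtain_count_list_take)
  have "m < k"
    using m(3) j count_list_take_mono[of k m x North] by (force simp: pos_def)
  then have "fst (pos x m) < i"
    using i count_list_take_mono[of m k x East] by (simp add: pos_def)
  moreover have "i \<le> count_list x East"
    using i k count_list_take_less[of k "length x" x East] by (simp add: pos_def)
  ultimately show "\<exists>m<length x. x ! m = North \<and> snd (pos x m) = j \<and>
      fst (pos x m) < i \<and> i \<le> count_list x East"
    using m by blast
next
  fix i m
  assume m: "m < length x" "x ! m = North"
    and i: "fst (pos x m) < i" "i \<le> count_list x East"
  then have "i - 1 < count_list x East"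
    by linarith
  then obtain k where k: "k < length x" "x ! k = East" "fst (pos x k) = i - 1"
    by (auto simp: pos_def elim: obtain_count_list_take)
  have "\<not> k < m"
    using k i count_list_take_less[of k m x East] by (auto simp: pos_def)
  moreover have "k \<noteq> m"
    using m k by auto
  ultimately have "snd (pos x m) < snd (pos x k)"
    using m count_list_take_less[of m k x North] by (simp add: pos_def)
  then show "(i, snd (pos x m)) \<in> squares_below x"
    using k i by (auto simp: squares_below_def)
qed

section \<open>Arithmetic progressions in a window\<close>

definition pos_part_div :: "nat \<Rightarrow> int \<Rightarrow> int" where
  "pos_part_div n u = int (nat u div n)"

lemma pos_part_div_nonpos: "u \<le> 0 \<Longrightarrow> pos_part_div n u = 0"
  by (simp add: pos_part_div_def)

lemma pos_part_div_diff:
  assumes "n > 0"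
  shows "pos_part_div n u - pos_part_div n (u - int n) = of_bool (int n \<le> u)"
proof (cases "int n \<le> u")
  case True
  then have "nat (u - int n) = nat u - n" "n \<le> nat u"
    by linarith+
  then show ?thesis
    using True assms by (simp add: pos_part_div_def le_div_geq)
next
  case False
  then have "nat u < n" "nat (u - int n) = 0"
    using assms by linarith+
  then show ?thesis
    using False by (simp add: pos_part_div_def)
qed

lemma card_progression_window:
  assumes "n > 0"
  shows "int (card {h. \<exists>q\<ge>1. h = c - int (q * n) \<and> a \<le> h \<and> h < a + int p})
           = pos_part_div n (c - a) - pos_part_div n (c - a - int p)"
proof -
  have mult_le_iff: "int (q * n) \<le> u \<longleftrightarrow> q \<le> nat u div n" if "q \<ge> 1" for q u
  proof -
    have "int (q * n) \<le> u \<longleftrightarrow> q * n \<le> nat u"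
      using that assms nat_le_eq_zle[of "int (q * n)" u] by (simp del: of_nat_mult)
    then show ?thesis
      using assms by (simp add: less_eq_div_iff_mult_less_eq)
  qed
  have "{h. \<exists>q\<ge>1. h = c - int (q * n) \<and> a \<le> h \<and> h < a + int p}
      = (\<lambda>q. c - int (q * n)) ` {q. q \<ge> 1 \<and> int (q * n) \<le> c - a \<and> \<not> int (q * n) \<le> c - a - int p}"
    by (auto simp: image_iff)
  also have "{q. q \<ge> 1 \<and> int (q * n) \<le> c - a \<and> \<not> int (q * n) \<le> c - a - int p}
      = {nat (c - a - int p) div n<..nat (c - a) div n}"
    using mult_le_iff by auto
  finally have "card {h. \<exists>q\<ge>1. h = c - int (q * n) \<and> a \<le> h \<and> h < a + int p}
      = card ((\<lambda>q. c - int (q * n)) ` {nat (c - a - int p) div n<..nat (c - a) div n})"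
    by (rule arg_cong)
  also have "\<dots> = card {nat (c - a - int p) div n<..nat (c - a) div n}"
    using assms by (intro card_image) (simp add: inj_on_def)
  finally have "card {h. \<exists>q\<ge>1. h = c - int (q * n) \<and> a \<le> h \<and> h < a + int p}
      = nat (c - a) div n - nat (c - a - int p) div n"
    by simp
  moreover have "nat (c - a - int p) div n \<le> nat (c - a) div n"
    by (intro div_le_mono nat_mono) simp
  ultimately show ?thesis
    by (simp add: pos_part_div_def)
qed

section \<open>Steps indexed by direction and rank\<close>

definition ranked_steps :: "nat \<Rightarrow> nat \<Rightarrow> (step \<times> nat) set" where
  "ranked_steps n p = Pair North ` {1..n} \<union> Pair East ` {1..p}"

lemma finite_ranked_steps: "finite (ranked_steps n p)"
  by (simp add: ranked_steps_def)

lemma North_in_ranked_steps: "(North, i) \<in> ranked_steps n p \<longleftrightarrow> i \<in> {1..n}"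
  and East_in_ranked_steps: "(East, k) \<in> ranked_steps n p \<longleftrightarrow> k \<in> {1..p}"
  by (auto simp: ranked_steps_def)

lemma sum_ranked_steps:
  "(\<Sum>a\<in>ranked_steps n p. f a) = (\<Sum>i=1..n. f (North, i)) + (\<Sum>k=1..p. f (East, k))"
  unfolding ranked_steps_def by (subst sum.union_disjoint) (auto simp: sum.reindex inj_on_def)

definition rank_increasing :: "nat \<Rightarrow> nat \<Rightarrow> (step \<times> nat \<Rightarrow> 'a :: linorder) \<Rightarrow> bool" where
  "rank_increasing n p F \<longleftrightarrow> inj_on F (ranked_steps n p) \<and>
     (\<forall>s. strict_mono_on {i. (s, i) \<in> ranked_steps n p} (\<lambda>i. F (s, i)))"

lemma rank_increasing_East_less_iff:
  assumes "rank_increasing n p F" "k \<in> {1..p}"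
  shows "F (East, k) < t \<longleftrightarrow> k \<le> card {j \<in> {1..p}. F (East, j) < t}"
proof -
  have "strict_mono_on {k. (East, k) \<in> ranked_steps n p} (\<lambda>k. F (East, k))"
    using assms(1) by (simp add: rank_increasing_def)
  then have "strict_mono_on {1..p} (\<lambda>k. F (East, k))"
    by (simp only: East_in_ranked_steps Collect_mem_eq)
  then show ?thesis
    using assms(2) by (rule strict_mono_on_less_iff_le_card)
qed

lemma rank_increasing_North_less_East_iff:
  assumes F: "rank_increasing n p F"
    and steps: "(North, i) \<in> ranked_steps n p" "(East, k) \<in> ranked_steps n p"
  shows "F (North, i) < F (East, k) \<longleftrightarrow> \<not> F (East, k) < F (North, i)"
proof -
  have "inj_on F (ranked_steps n p)"
    using F by (simp add: rank_increasing_def)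
  then have "F (North, i) \<noteq> F (East, k)"
    using inj_on_eq_iff[OF _ steps, of F] by simp
  then show ?thesis
    by (auto simp: not_less_iff_gr_or_eq)
qed

lemma rank_increasing_less_iff:
  assumes F: "rank_increasing n p F" and G: "rank_increasing n p G"
    and card_eq: "\<And>i. i \<in> {1..n} \<Longrightarrow>
      card {k \<in> {1..p}. F (East, k) < F (North, i)} = card {k \<in> {1..p}. G (East, k) < G (North, i)}"
    and ab: "a \<in> ranked_steps n p" "b \<in> ranked_steps n p"
  shows "F a < F b \<longleftrightarrow> G a < G b"
proof -
  have same_direction: "F (s, i) < F (s, j) \<longleftrightarrow> G (s, i) < G (s, j)"
    if "(s, i) \<in> ranked_steps n p" "(s, j) \<in> ranked_steps n p" for s i j
    using that F G strict_mono_on_less[of "{i. (s, i) \<in> ranked_steps n p}" "\<lambda>i. F (s, i)" i j]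
      strict_mono_on_less[of "{i. (s, i) \<in> ranked_steps n p}" "\<lambda>i. G (s, i)" i j]
    by (simp add: rank_increasing_def)
  have East_North: "F (East, k) < F (North, i) \<longleftrightarrow> G (East, k) < G (North, i)"
    if "(North, i) \<in> ranked_steps n p" "(East, k) \<in> ranked_steps n p" for i k
    using that card_eq rank_increasing_East_less_iff[OF F] rank_increasing_East_less_iff[OF G]
    by (simp only: North_in_ranked_steps East_in_ranked_steps)
  have North_East: "F (North, i) < F (East, k) \<longleftrightarrow> G (North, i) < G (East, k)"
    if "(North, i) \<in> ranked_steps n p" "(East, k) \<in> ranked_steps n p" for i k
    using rank_increasing_North_less_East_iff[OF F that]
      rank_increasing_North_less_East_iff[OF G that] East_North[OF that] by simp
  obtain s i t j where "a = (s, i)" "b = (t, j)"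
    by (metis surj_pair)
  then show ?thesis
    using ab same_direction East_North North_East by (cases s; cases t) blast+
qed

section \<open>Labels of a rational Dyck path\<close>

locale rational_dyck_path =
  fixes n p :: nat and x :: "step list"
  assumes n_pos: "n > 0" and coprime: "coprime n p" and dyck: "x \<in> rational_dyck_paths n p"
begin

definition label :: "nat \<Rightarrow> int" where
  "label k = lab n p (pos x k)"

definition label_change :: "step \<Rightarrow> int" where
  "label_change s = (case s of North \<Rightarrow> int p | East \<Rightarrow> - int n)"

definition labels_of :: "step \<Rightarrow> int set" where
  "labels_of s = label ` {k. k < length x \<and> x ! k = s}"

definition start_label :: "step \<times> nat \<Rightarrow> int" where
  "start_label = (\<lambda>(s, i). sorted_list_of_set (labels_of s) ! (i - 1))"

definition end_label :: "step \<times> nat \<Rightarrow> int" where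
  "end_label a = start_label a + label_change (fst a)"

lemma count_North: "count_list x North = n" and count_East: "count_list x East = p"
  using dyck by (simp_all add: rational_dyck_paths_def)

lemma length_path: "length x = n + p"
  by (simp add: length_eq_count_East_North count_North count_East)

lemma label_eq: "label k = int (snd (pos x k)) * int p - int (fst (pos x k)) * int n"
  by (simp add: label_def lab_def case_prod_beta)

lemma label_0: "label 0 = 0"
  by (simp add: label_eq pos_def)

lemma label_length: "label (length x) = 0"
  by (simp add: label_eq pos_def count_North count_East)

lemma label_nonneg: "k \<le> length x \<Longrightarrow> label k \<ge> 0"
  using dyck by (auto simp: label_eq rational_dyck_paths_def simp flip: of_nat_mult)

lemma label_Suc: "k < length x \<Longrightarrow> label (Suc k) = label k + label_change (x ! k)"
  by (cases "x ! k")
    (simp_all add: label_eq label_change_def pos_def count_list_take_Suc algebra_simps)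

lemma label_cong_index:
  assumes "k \<le> length x"
  shows "[label k = - int (k * n)] (mod int (n + p))"
proof -
  have "k = fst (pos x k) + snd (pos x k)"
    using assms length_eq_count_East_North[of "take k x"] by (simp add: pos_def)
  then have "int k = int (fst (pos x k)) + int (snd (pos x k))"
    by linarith
  then have "label k - - int (k * n) = int (snd (pos x k)) * int (n + p)"
    by (simp add: label_eq algebra_simps)
  then show ?thesis
    by (simp only: cong_iff_dvd_diff dvd_triv_right)
qed

lemma inj_on_label: "inj_on label {..<length x}"
proof (rule inj_onI)
  fix k m
  assume km: "k \<in> {..<length x}" "m \<in> {..<length x}" and eq: "label k = label m"
  have "[- int (k * n) = label m] (mod int (n + p))"
    using label_cong_index[of k] km eq by (simp add: cong_sym_eq)
  also have "[label m = - int (m * n)] (mod int (n + p))"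
    using km by (intro label_cong_index) simp
  finally have "[k * n = m * n] (mod (n + p))"
    by (simp only: cong_minus_minus_iff cong_int_iff)
  moreover have "coprime n (n + p)"
    using coprime by (simp add: coprime_iff_gcd_eq_1)
  ultimately have "[k = m] (mod (n + p))"
    by (simp only: cong_mult_rcancel_nat)
  then show "k = m"
    using km cong_less_modulus_unique_nat by (auto simp: length_path)
qed

lemma finite_labels_of: "finite (labels_of s)"
  by (simp add: labels_of_def)

lemma card_labels_of: "card (labels_of s) = count_list x s"
proof -
  have "inj_on label {k. k < length x \<and> x ! k = s}"
    using inj_on_label by (rule inj_on_subset) auto
  then show ?thesis
    by (simp add: labels_of_def card_image card_nth_eq_count_list)
qed

lemma labels_of_disjoint: "labels_of North \<inter> labels_of East = {}"
  by (auto simp: labels_of_def dest: inj_onD[OF inj_on_label])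

lemma labels_of_Un: "labels_of North \<union> labels_of East = label ` {..<length x}"
  by (auto simp: labels_of_def intro: step.exhaust)

lemma north_label_eq: "north_label n p x i = start_label (North, i)"
proof -
  have "north_labels n p x = labels_of North"
    by (auto simp: north_labels_def labels_of_def label_def)
  then show ?thesis
    by (simp add: north_label_def start_label_def)
qed

lemma strict_mono_on_start_label: "strict_mono_on {1..count_list x s} (\<lambda>i. start_label (s, i))"
  using strict_mono_on_nth_sorted_list_of_set[of "labels_of s"]
  by (simp add: start_label_def card_labels_of)

lemma bij_betw_start_label_labels_of:
  "bij_betw (\<lambda>i. start_label (s, i)) {1..count_list x s} (labels_of s)"
  using bij_betw_nth_sorted_list_of_set[OF finite_labels_of]
  by (simp add: start_label_def card_labels_of)

lemma bij_betw_start_label: "bij_betw start_label (ranked_steps n p) (label ` {..<length x})"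
proof -
  have "bij_betw start_label (Pair s ` {1..count_list x s}) (labels_of s)" for s
  proof -
    have "bij_betw (Pair s) {1..count_list x s} (Pair s ` {1..count_list x s})"
      by (intro inj_on_imp_bij_betw) (simp add: inj_on_def)
    then show ?thesis
      using bij_betw_start_label_labels_of[of s] by (simp add: bij_betw_comp_iff comp_def)
  qed
  from this[of North] this[of East] show ?thesis
    unfolding ranked_steps_def labels_of_Un[symmetric] count_North count_East
    using labels_of_disjoint by (rule bij_betw_combine)
qed

lemma start_label_in_labels_of:
  assumes "a \<in> ranked_steps n p"
  shows "start_label a \<in> labels_of (fst a)"
  using assms bij_betwE[OF bij_betw_start_label_labels_of[of "fst a"]]
  by (auto simp: ranked_steps_def count_North count_East)

lemma obtain_start_label:
  assumes "k < length x"
  obtains a where "a \<in> ranked_steps n p" "label k = start_label a"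
  using assms bij_betw_start_label by (metis bij_betw_imp_surj_on imageE imageI lessThan_iff)

lemma step_at_start_label:
  assumes "k < length x" "a \<in> ranked_steps n p" "label k = start_label a"
  shows "x ! k = fst a"
  using start_label_in_labels_of[OF assms(2)] assms
  by (auto simp: labels_of_def dest: inj_onD[OF inj_on_label])

lemma label_Suc_eq_end_label:
  assumes "k < length x" "a \<in> ranked_steps n p" "label k = start_label a"
  shows "label (Suc k) = end_label a"
  using step_at_start_label[OF assms] assms by (simp add: label_Suc end_label_def)

lemma bij_betw_end_label: "bij_betw end_label (ranked_steps n p) (label ` {..<length x})"
proof -
  have "label ` {..<length x} \<subseteq> end_label ` ranked_steps n p"
  proof clarify
    fix k
    assume "k < length x"
    define m where "m = (if k = 0 then length x - 1 else k - 1)"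
    have m: "m < length x" "label k = label (Suc m)"
      using \<open>k < length x\<close> by (auto simp: m_def label_0 label_length)
    then obtain a where "a \<in> ranked_steps n p" "label m = start_label a"
      using obtain_start_label by blast
    then show "label k \<in> end_label ` ranked_steps n p"
      using m label_Suc_eq_end_label by auto
  qed
  moreover have card_eq: "card (label ` {..<length x}) = card (ranked_steps n p)"
    using bij_betw_start_label bij_betw_same_card by metis
  then have "card (end_label ` ranked_steps n p) \<le> card (label ` {..<length x})"
    by (simp add: card_image_le finite_ranked_steps)
  ultimately have image_eq: "end_label ` ranked_steps n p = label ` {..<length x}"
    by (metis card_seteq finite_imageI finite_ranked_steps)
  then have "inj_on end_label (ranked_steps n p)"
    using card_eq finite_ranked_steps by (intro eq_card_imp_inj_on) auto
  then show ?thesis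
    using image_eq by (rule bij_betw_imageI)
qed

lemma rank_increasing_start_label: "rank_increasing n p start_label"
  unfolding rank_increasing_def
proof (intro conjI allI)
  show "inj_on start_label (ranked_steps n p)"
    using bij_betw_start_label by (rule bij_betw_imp_inj_on)
  fix s
  have "{i. (s, i) \<in> ranked_steps n p} = {1..count_list x s}"
    by (cases s) (auto simp: ranked_steps_def count_North count_East)
  then show "strict_mono_on {i. (s, i) \<in> ranked_steps n p} (\<lambda>i. start_label (s, i))"
    using strict_mono_on_start_label by simp
qed

lemma rank_increasing_end_label: "rank_increasing n p end_label"
  using bij_betw_end_label rank_increasing_start_label
  by (simp add: rank_increasing_def bij_betw_def end_label_def strict_mono_on_def)

lemma sum_label_differences:
  fixes f :: "int \<Rightarrow> int"
  shows "(\<Sum>i=1..n. f (end_label (North, i)) - f (start_label (North, i)))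
       = (\<Sum>k=1..p. f (start_label (East, k)) - f (end_label (East, k)))"
proof -
  have "(\<Sum>a\<in>ranked_steps n p. f (end_label a)) = (\<Sum>a\<in>ranked_steps n p. f (start_label a))"
    using sum.reindex_bij_betw[OF bij_betw_end_label, of f]
      sum.reindex_bij_betw[OF bij_betw_start_label, of f] by simp
  then show ?thesis
    by (simp add: sum_ranked_steps sum_subtractf)
qed

lemma start_label_North_cong_iff:
  assumes "i \<in> {1..n}" "j \<in> {1..n}"
  shows "[start_label (North, i) = start_label (North, j)] (mod int n) \<longleftrightarrow> i = j"
proof
  have north: "\<exists>k. k < length x \<and> x ! k = North \<and> start_label (North, i) = label k"
    if "i \<in> {1..n}" for i
    using start_label_in_labels_of[of "(North, i)"] that
    by (auto simp: North_in_ranked_steps labels_of_def)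
  obtain k m where k: "k < length x" "x ! k = North" "start_label (North, i) = label k"
    and m: "m < length x" "x ! m = North" "start_label (North, j) = label m"
    using north assms by blast
  have height_less: "snd (pos x k) < n" if "k < length x" "x ! k = North" for k
    using that count_list_take_less[of k "length x" x North] by (simp add: pos_def count_North)
  assume "[start_label (North, i) = start_label (North, j)] (mod int n)"
  then have "int n dvd label k - label m + int n * (int (fst (pos x k)) - int (fst (pos x m)))"
    by (simp add: cong_iff_dvd_diff k m)
  then have "[int (snd (pos x k) * p) = int (snd (pos x m) * p)] (mod int n)"
    by (simp add: cong_iff_dvd_diff label_eq algebra_simps)
  then have "[snd (pos x k) * p = snd (pos x m) * p] (mod n)"
    by (simp only: cong_int_iff)
  then have "[snd (pos x k) = snd (pos x m)] (mod n)"
    using coprime by (simp add: cong_mult_rcancel_nat coprime_commute)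
  then have "snd (pos x k) = snd (pos x m)"
    using height_less k m cong_less_modulus_unique_nat by blast
  then have "k = m"
    using inj_on_count_list_take[of x North] k m by (auto simp: pos_def dest: inj_onD)
  then have "start_label (North, i) = start_label (North, j)"
    using k m by simp
  then show "i = j"
    using strict_mono_on_eqD[OF strict_mono_on_start_label[of North]] assms count_North by metis
qed simp

section \<open>The codinv tableau\<close>

lemma lab_right_of_pos: "lab n p (fst (pos x m) + q, snd (pos x m)) = label m - int (q * n)"
  by (simp add: label_eq lab_def algebra_simps)

lemma H_eq: "H n p x = {h. h > 0 \<and> (\<exists>c\<in>labels_of North. \<exists>q\<ge>1. h = c - int (q * n))}"
proof (intro set_eqI iffI; clarify)
  fix h
  assume "h \<in> H n p x"
  then obtain i m where h: "h > 0" "h = lab n p (i, snd (pos x m))"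
    and m: "m < length x" "x ! m = North" "fst (pos x m) < i"
    by (auto simp: H_def squares_below_eq)
  define q where "q = i - fst (pos x m)"
  have "q \<ge> 1" "i = fst (pos x m) + q"
    using m(3) by (simp_all add: q_def)
  moreover from this have "h = label m - int (q * n)"
    using h(2) by (simp only: lab_right_of_pos)
  moreover have "label m \<in> labels_of North"
    using m by (auto simp: labels_of_def)
  ultimately show "h > 0 \<and> (\<exists>c\<in>labels_of North. \<exists>q\<ge>1. h = c - int (q * n))"
    using h(1) by blast
next
  fix c q
  assume "c \<in> labels_of North" and q: "(1 :: nat) \<le> q" and h: "c - int (q * n) > 0"
  then obtain m where m: "m < length x" "x ! m = North" "c = label m"
    by (auto simp: labels_of_def)
  define i where "i = fst (pos x m) + q"
  have lab: "c - int (q * n) = lab n p (i, snd (pos x m))"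
    by (simp add: m i_def lab_right_of_pos)
  have "int (i * n) < int (snd (pos x m) * p)"
    using h lab by (simp add: lab_def)
  then have "i * n < snd (pos x m) * p"
    by (simp only: of_nat_less_iff)
  also have "\<dots> \<le> n * p"
    using count_list_take_mono[of m "length x" x North] m by (simp add: pos_def count_North)
  finally have "i \<le> p"
    by (simp add: mult.commute)
  then have "(i, snd (pos x m)) \<in> squares_below x"
    using m q by (auto simp: squares_below_eq count_East i_def)
  then show "c - int (q * n) \<in> H n p x"
    unfolding H_def using h lab by auto
qed

lemma H_window_eq:
  assumes i: "i \<in> {1..n}" and j: "j \<in> {1..n}" and "i < j"
  defines "a \<equiv> start_label (North, i)" and "c \<equiv> start_label (North, j)"
  shows "{h \<in> H n p x. a < h \<and> h < a + int p \<and> [h = c] (mod int n)}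
           = {h. \<exists>q\<ge>1. h = c - int (q * n) \<and> a \<le> h \<and> h < a + int p}" (is "?L = ?R")
proof (intro set_eqI iffI)
  fix h
  assume "h \<in> ?L"
  then have h: "h \<in> H n p x" "a < h" "h < a + int p" "[h = c] (mod int n)"
    by blast+
  then obtain b q where b: "b \<in> labels_of North" "q \<ge> 1" "h = b - int (q * n)"
    unfolding H_eq by blast
  then have "b \<in> (\<lambda>i. start_label (North, i)) ` {1..n}"
    using bij_betw_imp_surj_on[OF bij_betw_start_label_labels_of[of North]] by (simp add: count_North)
  then obtain i' where i': "i' \<in> {1..n}" "b = start_label (North, i')"
    by blast
  have "[b = h] (mod int n)"
    by (simp add: b(3) cong_iff_dvd_diff)
  from this h(4) have "[b = c] (mod int n)"
    by (rule cong_trans)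
  then have "b = c"
    using start_label_North_cong_iff[OF i'(1) j] i'(2) by (simp add: c_def)
  then show "h \<in> ?R"
    using h b by auto
next
  fix h
  assume "h \<in> ?R"
  then obtain q where q: "q \<ge> 1" "h = c - int (q * n)" and window: "a \<le> h" "h < a + int p"
    by blast
  have cong: "[h = c] (mod int n)"
    by (simp add: q(2) cong_iff_dvd_diff)
  then have "h \<noteq> a"
    using start_label_North_cong_iff[OF i j] \<open>i < j\<close> by (auto simp: a_def c_def)
  then have "a < h"
    using window by simp
  moreover have "a \<ge> 0" "c \<in> labels_of North"
    using i j start_label_in_labels_of[of "(North, i)"] start_label_in_labels_of[of "(North, j)"]
      label_nonneg by (auto simp: a_def c_def North_in_ranked_steps labels_of_def)
  ultimately show "h \<in> ?L"
    using q window cong by (auto simp: H_eq)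
qed

lemma codinv_eq:
  assumes "i \<in> {1..n}" "j \<in> {1..n}" "i < j"
  shows "int (codinv n p x i j) = pos_part_div n (start_label (North, j) - start_label (North, i))
           - pos_part_div n (start_label (North, j) - start_label (North, i) - int p)"
  unfolding codinv_def north_label_eq H_window_eq[OF assms] by (rule card_progression_window[OF n_pos])

lemma codinv_eq_end_label:
  assumes "i \<in> {1..n}" "j \<in> {1..n}"
  shows "int (if i < j then codinv n p x i j else 0) =
           pos_part_div n (start_label (North, j) - start_label (North, i))
           - pos_part_div n (start_label (North, j) - end_label (North, i))"
proof (cases "i < j")
  case True
  then show ?thesis
    using codinv_eq[OF assms] by (simp add: end_label_def label_change_def algebra_simps)
next
  case False
  then have "start_label (North, j) \<le> start_label (North, i)"
    using assms strict_mono_on_leD[OF strict_mono_on_start_label[of North]] by (simp add: count_North)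
  then show ?thesis
    using False by (simp add: pos_part_div_nonpos end_label_def label_change_def)
qed

lemma codinv_column_sum:
  assumes j: "j \<in> {1..n}"
  shows "(\<Sum>i | i \<in> {1..n} \<and> i < j. codinv n p x i j)
           = card {k \<in> {1..p}. start_label (East, k) < start_label (North, j)}"
proof -
  define f where "f t = - pos_part_div n (start_label (North, j) - t)" for t
  have "int (\<Sum>i | i \<in> {1..n} \<and> i < j. codinv n p x i j)
      = (\<Sum>i=1..n. int (if i < j then codinv n p x i j else 0))"
    by (subst sum.inter_filter) (simp_all only: finite_atLeastAtMost of_nat_sum)
  also have "\<dots> = (\<Sum>i=1..n. f (end_label (North, i)) - f (start_label (North, i)))"
    using j codinv_eq_end_label by (simp add: f_def)
  also have "\<dots> = (\<Sum>k=1..p. f (start_label (East, k)) - f (end_label (East, k)))"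
    by (rule sum_label_differences)
  also have "\<dots> = (\<Sum>k=1..p. of_bool (start_label (East, k) < start_label (North, j)))"
  proof (rule sum.cong)
    fix k assume "k \<in> {1..p}"
    then have "start_label (East, k) \<noteq> start_label (North, j)"
      using j inj_on_eq_iff[OF bij_betw_imp_inj_on[OF bij_betw_start_label]]
      by (simp add: North_in_ranked_steps East_in_ranked_steps)
    then show "f (start_label (East, k)) - f (end_label (East, k))
        = of_bool (start_label (East, k) < start_label (North, j))"
      using pos_part_div_diff[OF n_pos, of "start_label (North, j) - end_label (East, k)"]
      by (auto simp: f_def end_label_def label_change_def algebra_simps)
  qed simp
  also have "\<dots> = int (card {k \<in> {1..p}. start_label (East, k) < start_label (North, j)})"
    by (simp add: Int_def)
  finally show ?thesis
    by (simp only: of_nat_eq_iff)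
qed

lemma codinv_row_sum:
  assumes i: "i \<in> {1..n}"
  shows "(\<Sum>j | j \<in> {1..n} \<and> i < j. codinv n p x i j)
           + card {k \<in> {1..p}. end_label (East, k) < end_label (North, i)} = p"
proof -
  define f where "f t = pos_part_div n (t - end_label (North, i))" for t
  have "int (\<Sum>j | j \<in> {1..n} \<and> i < j. codinv n p x i j)
      = (\<Sum>j=1..n. int (if i < j then codinv n p x i j else 0))"
    by (subst sum.inter_filter) (simp_all only: finite_atLeastAtMost of_nat_sum)
  also have "\<dots> = (\<Sum>j=1..n. f (end_label (North, j)) - f (start_label (North, j)))"
    using codinv_eq_end_label[OF i]
    by (intro sum.cong) (auto simp: f_def end_label_def label_change_def)
  also have "\<dots> = (\<Sum>k=1..p. f (start_label (East, k)) - f (end_label (East, k)))"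
    by (rule sum_label_differences)
  also have "\<dots> = (\<Sum>k=1..p. 1 - of_bool (end_label (East, k) < end_label (North, i)))"
  proof (rule sum.cong)
    fix k
    show "f (start_label (East, k)) - f (end_label (East, k))
        = 1 - of_bool (end_label (East, k) < end_label (North, i))"
      using pos_part_div_diff[OF n_pos, of "start_label (East, k) - end_label (North, i)"]
      by (auto simp: f_def end_label_def label_change_def algebra_simps)
  qed simp
  also have "\<dots> = int p - int (card {k \<in> {1..p}. end_label (East, k) < end_label (North, i)})"
    by (simp add: sum_subtractf Int_def)
  finally show ?thesis
    by linarith
qed

end

section \<open>Reconstruction of the path\<close>

locale codinv_equal_paths =
  X: rational_dyck_path n p x + Y: rational_dyck_path n p y for n p x y +
  assumes codinv_equal:
    "\<And>i j. i \<in> {1..n} \<Longrightarrow> j \<in> {1..n} \<Longrightarrow> i < j \<Longrightarrow> codinv n p x i j = codinv n p y i j"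
begin

lemma start_label_less_iff:
  assumes "a \<in> ranked_steps n p" "b \<in> ranked_steps n p"
  shows "X.start_label a < X.start_label b \<longleftrightarrow> Y.start_label a < Y.start_label b"
proof (rule rank_increasing_less_iff[OF X.rank_increasing_start_label Y.rank_increasing_start_label _ assms])
  fix j
  assume j: "j \<in> {1..n}"
  then have "(\<Sum>i | i \<in> {1..n} \<and> i < j. codinv n p x i j) = (\<Sum>i | i \<in> {1..n} \<and> i < j. codinv n p y i j)"
    using codinv_equal by (intro sum.cong) auto
  then show "card {k \<in> {1..p}. X.start_label (East, k) < X.start_label (North, j)}
      = card {k \<in> {1..p}. Y.start_label (East, k) < Y.start_label (North, j)}"
    using X.codinv_column_sum[OF j] Y.codinv_column_sum[OF j] by simp
qed

lemma end_label_less_iff: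
  assumes "a \<in> ranked_steps n p" "b \<in> ranked_steps n p"
  shows "X.end_label a < X.end_label b \<longleftrightarrow> Y.end_label a < Y.end_label b"
proof (rule rank_increasing_less_iff[OF X.rank_increasing_end_label Y.rank_increasing_end_label _ assms])
  fix i
  assume i: "i \<in> {1..n}"
  then have "(\<Sum>j | j \<in> {1..n} \<and> i < j. codinv n p x i j) = (\<Sum>j | j \<in> {1..n} \<and> i < j. codinv n p y i j)"
    using codinv_equal by (intro sum.cong) auto
  then show "card {k \<in> {1..p}. X.end_label (East, k) < X.end_label (North, i)}
      = card {k \<in> {1..p}. Y.end_label (East, k) < Y.end_label (North, i)}"
    using X.codinv_row_sum[OF i] Y.codinv_row_sum[OF i] by linarith
qed

lemma start_label_eq_end_label_iff:
  assumes "a \<in> ranked_steps n p" "b \<in> ranked_steps n p"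
  shows "X.start_label a = X.end_label b \<longleftrightarrow> Y.start_label a = Y.end_label b"
  by (rule bij_betw_matching_determined_by_order[OF finite_ranked_steps
        X.bij_betw_start_label X.bij_betw_end_label Y.bij_betw_start_label Y.bij_betw_end_label
        start_label_less_iff end_label_less_iff assms])

lemma label_eq_start_label_transfer:
  assumes "k < length x" "a \<in> ranked_steps n p" "X.label k = X.start_label a"
  shows "Y.label k = Y.start_label a"
  using assms
proof (induction k arbitrary: a)
  case 0
  have "0 < length y"
    using 0 by (simp add: X.length_path Y.length_path)
  then obtain b where b: "b \<in> ranked_steps n p" "Y.label 0 = Y.start_label b"
    using Y.obtain_start_label by blast
  have "X.start_label b \<in> X.label ` {..<length x}" "Y.start_label a \<in> Y.label ` {..<length y}"
    using b 0 bij_betwE[OF X.bij_betw_start_label] bij_betwE[OF Y.bij_betw_start_label] by auto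
  then have "0 \<le> X.start_label b" "0 \<le> Y.start_label a"
    using X.label_nonneg Y.label_nonneg by auto
  then have "\<not> Y.start_label b < Y.start_label a"
    using start_label_less_iff[OF b(1) 0(2)] 0(3) X.label_0 by simp
  then show ?case
    using b(2) \<open>0 \<le> Y.start_label a\<close> Y.label_0 by simp
next
  case (Suc k)
  then obtain b where b: "b \<in> ranked_steps n p" "X.label k = X.start_label b"
    using X.obtain_start_label Suc_lessD by metis
  have k: "k < length x" "k < length y"
    using Suc.prems by (simp_all add: X.length_path Y.length_path)
  have "X.start_label a = X.end_label b"
    using X.label_Suc_eq_end_label[OF k(1) b] Suc.prems by simp
  then have "Y.start_label a = Y.end_label b"
    using start_label_eq_end_label_iff Suc.prems(2) b(1) by blast
  then show ?case
    using Y.label_Suc_eq_end_label[OF k(2) b(1) Suc.IH[OF k(1) b]] by simp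
qed

end

theorem theorem3p6:
  fixes n p :: nat and x y :: "step list"
  assumes "n > 0" and "p > 0" and "coprime n p"
    and "x \<in> rational_dyck_paths n p" and "y \<in> rational_dyck_paths n p"
    and "\<And>i j. i \<in> {1..n} \<Longrightarrow> j \<in> {1..n} \<Longrightarrow> i < j \<Longrightarrow> codinv n p x i j = codinv n p y i j"
  shows "x = y"
proof -
  interpret codinv_equal_paths n p x y
    using assms by unfold_locales
  show ?thesis
  proof (rule nth_equalityI)
    show len: "length x = length y"
      by (simp add: X.length_path Y.length_path)
    fix k
    assume k: "k < length x"
    then obtain a where a: "a \<in> ranked_steps n p" "X.label k = X.start_label a"
      using X.obtain_start_label by blast
    then have "Y.label k = Y.start_label a"
      using k label_eq_start_label_transfer by blast
    then show "x ! k = y ! k"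
      using X.step_at_start_label[OF k a] Y.step_at_start_label[OF _ a(1)] k len by simp
  qed
qed

end
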